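(* Let $\mathbb F\in\{\mathbb R,\mathbb C\}$ and let $(\mathcal X,\|\cdot\|)$ be a finite-dimensional normed space over $\mathbb F$. Then the following conditions are equivalent: (i) There exists a linear bijection $A\colon\mathcal X\to\mathbb F^n$, for some $n\in\mathbb N$, such that $\|x\|=\|Ax\|_\infty$ for all $x\in\mathcal X$. (ii) The cardinality of $\{x^\perp : x\in\Gamma(\mathcal X),\ x \text{ is smooth}\}$ is minimal possible among all the norms on the vector space $\mathcal X$. (iii) $|\{x^\perp : x\in\Gamma(\mathcal X),\ x\text{ is smooth}\}|=\dim\mathcal X$.
   Context: For $x,y$ in a normed space $\mathcal X$ over $\mathbb F$, $x\perp y$ (Birkhoff--James orthogonality) means $\|x+\lambda y\|\ge\|x\|$ for all $\lambda\in\mathbb F$. $\Gamma(\mathcal X)$ is the directed graph whose vertices are the one-dimensional subspaces $[x]=\mathbb F x$, $x\in\mathcal X\setminus\{0\}$, with an edge $[x]\rightarrow[y]$ if and only if $x\perp y$. Elements of $\Gamma(\mathcal X)$ are denoted simply $x$; $x^\perp=\{y\in\Gamma(\mathcal X) : x\rightarrow y\}$ is the outgoing neighborhood. A nonzero vector is smooth if it has a unique supporting functional (a functional $f\in\mathcal X^*$ with $\|f\|=1$ and $f(x)=\|x\|$); a point $[x]$ is smooth if some (equivalently every) nonzero representative is smooth. $\|(a_1,\dots,a_n)\|_\infty=\max_i|a_i|$. *)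

theory Defs
  imports Complex_Main "HOL-Library.Function_Algebras" "HOL-Library.Equipollence"
begin

text \<open>
  Since conditions on all norms of a fixed vector space are needed, a normed space is given by a
  scalar multiplication \<open>s\<close> on a type of class \<open>ab_group_add\<close> together with an explicit norm
  \<open>N\<close>; the scalar type \<open>'f\<close> is meant to be \<open>real\<close> or \<open>complex\<close>.
\<close>

definition norm_on :: "('f::real_normed_field \<Rightarrow> 'a::ab_group_add \<Rightarrow> 'a) \<Rightarrow> ('a \<Rightarrow> real) \<Rightarrow> bool" where
  "norm_on s N \<longleftrightarrow>
     (\<forall>x. 0 \<le> N x) \<and>
     (\<forall>x. N x = 0 \<longleftrightarrow> x = 0) \<and>
     (\<forall>c x. N (s c x) = norm c * N x) \<and>
     (\<forall>x y. N (x + y) \<le> N x + N y)"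

definition bj_orthogonal ::
  "('f::real_normed_field \<Rightarrow> 'a::ab_group_add \<Rightarrow> 'a) \<Rightarrow> ('a \<Rightarrow> real) \<Rightarrow> 'a \<Rightarrow> 'a \<Rightarrow> bool" where
  "bj_orthogonal s N x y \<longleftrightarrow> (\<forall>c. N (x + s c y) \<ge> N x)"

definition line :: "('f::real_normed_field \<Rightarrow> 'a::ab_group_add \<Rightarrow> 'a) \<Rightarrow> 'a \<Rightarrow> 'a set" where
  "line s x = range (\<lambda>c. s c x)"

definition Gamma_verts :: "('f::real_normed_field \<Rightarrow> 'a::ab_group_add \<Rightarrow> 'a) \<Rightarrow> 'a set set" where
  "Gamma_verts s = {line s x | x. x \<noteq> 0}"

text \<open>The relation does not depend on the choice of the nonzero representatives.\<close>

definition Gamma_arcs ::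
  "('f::real_normed_field \<Rightarrow> 'a::ab_group_add \<Rightarrow> 'a) \<Rightarrow> ('a \<Rightarrow> real) \<Rightarrow> ('a set \<times> 'a set) set" where
  "Gamma_arcs s N = {(line s x, line s y) | x y. x \<noteq> 0 \<and> y \<noteq> 0 \<and> bj_orthogonal s N x y}"

definition out_nbhd ::
  "('f::real_normed_field \<Rightarrow> 'a::ab_group_add \<Rightarrow> 'a) \<Rightarrow> ('a \<Rightarrow> real) \<Rightarrow> 'a set \<Rightarrow> 'a set set" where
  "out_nbhd s N p = {q \<in> Gamma_verts s. (p, q) \<in> Gamma_arcs s N}"

definition dual_space ::
  "('f::real_normed_field \<Rightarrow> 'a::ab_group_add \<Rightarrow> 'a) \<Rightarrow> ('a \<Rightarrow> real) \<Rightarrow> ('a \<Rightarrow> 'f) set" where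
  "dual_space s N = {f. Vector_Spaces.linear s (*) f \<and> (\<exists>K. \<forall>x. norm (f x) \<le> K * N x)}"

text \<open>
  As for \<open>onorm\<close> in HOL-Analysis, the term for \<open>x = 0\<close> is \<open>0 / 0 = 0\<close>.
\<close>

definition dual_norm :: "('a \<Rightarrow> real) \<Rightarrow> ('a \<Rightarrow> 'f::real_normed_field) \<Rightarrow> real" where
  "dual_norm N f = (SUP x. norm (f x) / N x)"

definition supporting_functional ::
  "('f::real_normed_field \<Rightarrow> 'a::ab_group_add \<Rightarrow> 'a) \<Rightarrow> ('a \<Rightarrow> real) \<Rightarrow> 'a \<Rightarrow> ('a \<Rightarrow> 'f) \<Rightarrow> bool" where
  "supporting_functional s N x f \<longleftrightarrow>
     f \<in> dual_space s N \<and> dual_norm N f = 1 \<and> f x = of_real (N x)"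

definition smooth_vector ::
  "('f::real_normed_field \<Rightarrow> 'a::ab_group_add \<Rightarrow> 'a) \<Rightarrow> ('a \<Rightarrow> real) \<Rightarrow> 'a \<Rightarrow> bool" where
  "smooth_vector s N x \<longleftrightarrow> x \<noteq> 0 \<and> (\<exists>!f. supporting_functional s N x f)"

definition smooth_point ::
  "('f::real_normed_field \<Rightarrow> 'a::ab_group_add \<Rightarrow> 'a) \<Rightarrow> ('a \<Rightarrow> real) \<Rightarrow> 'a set \<Rightarrow> bool" where
  "smooth_point s N p \<longleftrightarrow> (\<exists>x. x \<noteq> 0 \<and> p = line s x \<and> smooth_vector s N x)"

definition smooth_out_nbhds ::
  "('f::real_normed_field \<Rightarrow> 'a::ab_group_add \<Rightarrow> 'a) \<Rightarrow> ('a \<Rightarrow> real) \<Rightarrow> 'a set set set" where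
  "smooth_out_nbhds s N = {out_nbhd s N p | p. p \<in> Gamma_verts s \<and> smooth_point s N p}"

text \<open>
  The space of \<open>n\<close>-tuples over \<open>'f\<close>: sequences vanishing from index \<open>n\<close> on, with the pointwise
  operations (addition is the one of HOL-Library.Function_Algebras).
\<close>

definition tuples :: "nat \<Rightarrow> (nat \<Rightarrow> 'f::real_normed_field) set" where
  "tuples n = {v. \<forall>i\<ge>n. v i = 0}"

definition tuple_scale :: "'f::real_normed_field \<Rightarrow> (nat \<Rightarrow> 'f) \<Rightarrow> nat \<Rightarrow> 'f" where
  "tuple_scale c v = (\<lambda>i. c * v i)"

text \<open>Inserting \<open>0\<close> only matters for \<open>n = 0\<close>, where the norm is \<open>0\<close>.\<close>

definition max_norm :: "nat \<Rightarrow> (nat \<Rightarrow> 'f::real_normed_field) \<Rightarrow> real" where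
  "max_norm n v = Max (insert 0 ((\<lambda>i. norm (v i)) ` {..<n}))"

definition isometric_to_max_norm ::
  "('f::real_normed_field \<Rightarrow> 'a::ab_group_add \<Rightarrow> 'a) \<Rightarrow> ('a \<Rightarrow> real) \<Rightarrow> bool" where
  "isometric_to_max_norm s N \<longleftrightarrow>
     (\<exists>n A. Vector_Spaces.linear s tuple_scale A \<and> bij_betw A UNIV (tuples n) \<and>
            (\<forall>x. N x = max_norm n (A x)))"

text \<open>
  The sets compared may be infinite, so sizes are compared by the existence of an injection.
\<close>

definition minimal_smooth_out_nbhds ::
  "('f::real_normed_field \<Rightarrow> 'a::ab_group_add \<Rightarrow> 'a) \<Rightarrow> ('a \<Rightarrow> real) \<Rightarrow> bool" where
  "minimal_smooth_out_nbhds s N \<longleftrightarrow>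
     (\<forall>M. norm_on s M \<longrightarrow> smooth_out_nbhds s N \<lesssim> smooth_out_nbhds s M)"

definition dim_many_smooth_out_nbhds ::
  "('f::real_normed_field \<Rightarrow> 'a::ab_group_add \<Rightarrow> 'a) \<Rightarrow> ('a \<Rightarrow> real) \<Rightarrow> bool" where
  "dim_many_smooth_out_nbhds s N \<longleftrightarrow>
     finite (smooth_out_nbhds s N) \<and> card (smooth_out_nbhds s N) = vector_space.dim s UNIV"

end

theory Submission
  imports Defs "HOL-Analysis.Function_Topology" "HOL-Analysis.Topology_Euclidean_Space"
begin

text \<open>
  Fix Euclidean coordinates. For \<open>N p < 1\<close> let \<open>q\<close> be a Euclidean nearest point to \<open>p\<close> outside the
  open unit ball of \<open>N\<close>. A Euclidean ball inside the unit ball touches its sphere at \<open>q\<close>, so \<open>q\<close> is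
  smooth, and its outgoing neighbourhood is the kernel of its supporting functional. Letting \<open>p\<close>
  tend to the unit sphere shows that such points are dense in it, so their supporting functionals
  norm the space. Finitely many neighbourhoods therefore give finitely many functionals \<open>f\<^sub>i\<close> with
  \<open>N x = max\<^sub>i \<bar>f\<^sub>i x\<bar>\<close>: there are at least \<open>dim\<close> of them, and if there are exactly \<open>dim\<close>, they are
  the coordinates of an isometry onto the maximum norm. Conversely, in the maximum norm the
  neighbourhoods of smooth points are exactly the coordinate hyperplanes.
\<close>

section \<open>Supporting functionals and outgoing neighbourhoods in a normed space\<close>

locale norm_space = vector_space scale
  for scale :: "'f::real_normed_field \<Rightarrow> 'a::ab_group_add \<Rightarrow> 'a" (infixr \<open>\<odot>\<close> 75) +
  fixes N :: "'a \<Rightarrow> real"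
  assumes norm_on: "norm_on scale N"
begin

lemma N_nonneg [simp]: "0 \<le> N x"
  and N_eq_0_iff [simp]: "N x = 0 \<longleftrightarrow> x = 0"
  and N_scale: "N (c \<odot> x) = norm c * N x"
  and N_triangle: "N (x + y) \<le> N x + N y"
  using norm_on by (auto simp: norm_on_def)

lemma N_zero [simp]: "N 0 = 0"
  by simp

lemma N_pos_iff [simp]: "0 < N x \<longleftrightarrow> x \<noteq> 0"
  using N_nonneg[of x] N_eq_0_iff[of x] by linarith

lemma N_minus [simp]: "N (- x) = N x"
  using N_scale[of "-1" x] by simp

lemma N_minus_commute: "N (x - y) = N (y - x)"
  using N_minus[of "x - y"] by simp

lemma N_triangle_sub: "N x - N y \<le> N (x - y)"
  using N_triangle[of "x - y" y] by simp

lemma N_sum: "finite I \<Longrightarrow> N (\<Sum>i\<in>I. g i) \<le> (\<Sum>i\<in>I. N (g i))"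
  by (induction I rule: finite_induct) (auto intro: order_trans[OF N_triangle])

text \<open>Since \<open>f x = N x\<close> makes the quotient at the nonzero \<open>x\<close> equal
  to 1, dual norm 1 amounts to the pointwise bound. This removes the supremum from all later
  arguments.\<close>

lemma supporting_functional_iff:
  assumes "x \<noteq> 0"
  shows "supporting_functional scale N x f \<longleftrightarrow>
    Vector_Spaces.linear scale (*) f \<and> (\<forall>y. norm (f y) \<le> N y) \<and> f x = of_real (N x)"
    (is "?lhs \<longleftrightarrow> ?rhs")
proof
  assume f: ?lhs
  then have lin: "Vector_Spaces.linear scale (*) f" and fx: "f x = of_real (N x)"
    and d: "dual_norm N f = 1"
    by (auto simp: supporting_functional_def dual_space_def)
  from f obtain K where K: "\<And>x. norm (f x) \<le> K * N x"
    by (auto simp: supporting_functional_def dual_space_def)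
  \<comment> \<open>The absolute value gives a nonnegative bound, as the zero quotient at
    \<open>y = 0\<close> requires.\<close>
  have "norm (f y) / N y \<le> \<bar>K\<bar>" for y
    using order_trans[OF K[of y] mult_right_mono[of K "\<bar>K\<bar>" "N y"]]
    by (cases "y = 0") (auto simp: divide_simps)
  then have bdd: "bdd_above (range (\<lambda>y. norm (f y) / N y))"
    by (auto simp: bdd_above_def)
  have "norm (f y) \<le> N y" for y
  proof (cases "y = 0")
    case True
    then show ?thesis using K[of y] by simp
  next
    case False
    have "norm (f y) / N y \<le> 1"
      using cSUP_upper[OF _ bdd, of y] d by (simp add: dual_norm_def)
    then show ?thesis using False by (simp add: divide_simps)
  qed
  with lin fx show ?rhs by blast
next
  assume f: ?rhs
  then have le: "norm (f y) / N y \<le> 1" for y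
    by (cases "y = 0") (auto simp: divide_simps)
  have "norm (f x) / N x = 1"
    using f assms by simp
  then have "dual_norm N f = 1"
    unfolding dual_norm_def using le by (intro cSup_eq_maximum) (auto intro: image_eqI[of _ _ x])
  moreover have "\<forall>y. norm (f y) \<le> 1 * N y"
    using f by simp
  ultimately show ?lhs
    unfolding supporting_functional_def dual_space_def using f by blast
qed

lemma bj_orthogonal_scale_left:
  assumes "bj_orthogonal scale N x y"
  shows "bj_orthogonal scale N (c \<odot> x) y"
  unfolding bj_orthogonal_def
proof
  fix d
  show "N (c \<odot> x) \<le> N (c \<odot> x + d \<odot> y)"
  proof (cases "c = 0")
    case False
    have "N x \<le> N (x + (d / c) \<odot> y)"
      using assms by (simp add: bj_orthogonal_def)
    then have "norm c * N x \<le> norm c * N (x + (d / c) \<odot> y)"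
      by (simp add: mult_left_mono)
    also have "\<dots> = N (c \<odot> x + d \<odot> y)"
      using False by (simp add: N_scale[symmetric] scale_right_distrib)
    finally show ?thesis by (simp add: N_scale)
  qed simp
qed

lemma bj_orthogonal_scale_right:
  "bj_orthogonal scale N x y \<Longrightarrow> bj_orthogonal scale N x (c \<odot> y)"
  by (simp add: bj_orthogonal_def)

lemma line_eqD:
  assumes "line scale x = line scale y"
  obtains c where "x = c \<odot> y"
proof -
  have "x = 1 \<odot> x"
    by simp
  then have "x \<in> line scale x"
    unfolding line_def by blast
  then have "x \<in> line scale y"
    using assms by simp
  with that show thesis
    unfolding line_def by blast
qed

text \<open>An arc only provides some orthogonal pair of representatives; homogeneity on both sides
  carries orthogonality over to the given \<open>x\<close> and \<open>y\<close>.\<close>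

lemma line_in_out_nbhd_iff:
  assumes "x \<noteq> 0" "y \<noteq> 0"
  shows "line scale y \<in> out_nbhd scale N (line scale x) \<longleftrightarrow> bj_orthogonal scale N x y"
proof
  assume "line scale y \<in> out_nbhd scale N (line scale x)"
  then obtain x' y' where l: "line scale x = line scale x'" "line scale y = line scale y'"
    and o: "bj_orthogonal scale N x' y'"
    by (auto simp: out_nbhd_def Gamma_arcs_def)
  obtain c where c: "x = c \<odot> x'" using line_eqD[OF l(1)] .
  obtain d where d: "y = d \<odot> y'" using line_eqD[OF l(2)] .
  show "bj_orthogonal scale N x y"
    unfolding c d by (intro bj_orthogonal_scale_left bj_orthogonal_scale_right o)
next
  assume "bj_orthogonal scale N x y"
  with assms have "(line scale x, line scale y) \<in> Gamma_arcs scale N" "line scale y \<in> Gamma_verts scale"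
    unfolding Gamma_arcs_def Gamma_verts_def by blast+
  then show "line scale y \<in> out_nbhd scale N (line scale x)"
    by (simp add: out_nbhd_def)
qed

lemma out_nbhd_line_eqI:
  assumes "x \<noteq> 0" "\<And>y. y \<noteq> 0 \<Longrightarrow> bj_orthogonal scale N x y \<longleftrightarrow> P y"
  shows "out_nbhd scale N (line scale x) = {line scale y | y. y \<noteq> 0 \<and> P y}"
proof -
  have "q \<in> out_nbhd scale N (line scale x) \<longleftrightarrow> (\<exists>y. q = line scale y \<and> y \<noteq> 0 \<and> P y)" for q
  proof
    assume q: "q \<in> out_nbhd scale N (line scale x)"
    then obtain y where "y \<noteq> 0" "q = line scale y"
      by (auto simp: out_nbhd_def Gamma_verts_def)
    then show "\<exists>y. q = line scale y \<and> y \<noteq> 0 \<and> P y"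
      using q line_in_out_nbhd_iff[OF assms(1), of y] assms(2)[of y] by auto
  next
    assume "\<exists>y. q = line scale y \<and> y \<noteq> 0 \<and> P y"
    then obtain y where "q = line scale y" "y \<noteq> 0" "P y"
      by auto
    then show "q \<in> out_nbhd scale N (line scale x)"
      using line_in_out_nbhd_iff[OF assms(1), of y] assms(2)[of y] by simp
  qed
  then show ?thesis
    by (intro set_eqI) simp
qed

lemma smooth_out_nbhds_eq:
  "smooth_out_nbhds scale N = {out_nbhd scale N (line scale x) | x. smooth_vector scale N x}"
  by (auto simp: smooth_out_nbhds_def smooth_point_def smooth_vector_def Gamma_verts_def)

end

section \<open>The space of tuples and the maximum norm\<close>

interpretation tuple: vector_space "tuple_scale :: 'f::real_normed_field \<Rightarrow> (nat \<Rightarrow> 'f) \<Rightarrow> nat \<Rightarrow> 'f"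
  by unfold_locales (auto simp: tuple_scale_def algebra_simps fun_eq_iff)

definition tuple_unit :: "nat \<Rightarrow> nat \<Rightarrow> 'f::real_normed_field" where
  "tuple_unit i = (\<lambda>j. if j = i then 1 else 0)"

lemma sum_fun_apply: "(\<Sum>i\<in>I. g i) x = (\<Sum>i\<in>I. g i x)"
  by (induction I rule: infinite_finite_induct) auto

lemma tuple_unit_in_tuples: "i < n \<Longrightarrow> tuple_unit i \<in> tuples n"
  by (auto simp: tuples_def tuple_unit_def)

lemma sum_tuple_unit: "(\<Sum>i<n. tuple_scale (c i) (tuple_unit i)) = (\<lambda>j. if j < n then c j else 0)"
proof
  fix j
  have "tuple_scale (c i) (tuple_unit i) j = (if j = i then c i else 0)" for i
    by (simp add: tuple_scale_def tuple_unit_def)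
  then show "(\<Sum>i<n. tuple_scale (c i) (tuple_unit i)) j = (if j < n then c j else 0)"
    by (simp add: sum_fun_apply)
qed

lemma inj_tuple_unit: "inj (tuple_unit :: nat \<Rightarrow> nat \<Rightarrow> 'f::real_normed_field)"
proof (rule injI)
  fix i j assume "(tuple_unit i :: nat \<Rightarrow> 'f) = tuple_unit j"
  from fun_cong[OF this, of i] show "i = j"
    by (simp add: tuple_unit_def split: if_splits)
qed

lemma span_tuple_unit:
  "tuple.span (tuple_unit ` {..<n}) = (tuples n :: (nat \<Rightarrow> 'f::real_normed_field) set)"
proof
  have "tuple.subspace (tuples n :: (nat \<Rightarrow> 'f) set)"
    by (auto simp: tuple.subspace_def tuples_def tuple_scale_def)
  then show "tuple.span (tuple_unit ` {..<n}) \<subseteq> (tuples n :: (nat \<Rightarrow> 'f) set)"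
    by (intro tuple.span_minimal) (auto intro: tuple_unit_in_tuples)
next
  show "(tuples n :: (nat \<Rightarrow> 'f) set) \<subseteq> tuple.span (tuple_unit ` {..<n})"
  proof
    fix v :: "nat \<Rightarrow> 'f"
    assume "v \<in> tuples n"
    then have "v = (\<Sum>i<n. tuple_scale (v i) (tuple_unit i))"
      unfolding sum_tuple_unit by (auto simp: tuples_def fun_eq_iff)
    also have "\<dots> \<in> tuple.span (tuple_unit ` {..<n})"
      by (intro tuple.span_sum tuple.span_scale tuple.span_base) auto
    finally show "v \<in> tuple.span (tuple_unit ` {..<n})" .
  qed
qed

lemma independent_tuple_unit:
  "tuple.independent ((tuple_unit :: nat \<Rightarrow> nat \<Rightarrow> 'f::real_normed_field) ` {..<n})"
proof (rule tuple.independent_if_scalars_zero)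
  fix f :: "(nat \<Rightarrow> 'f) \<Rightarrow> 'f" and v :: "nat \<Rightarrow> 'f"
  assume "(\<Sum>v\<in>tuple_unit ` {..<n}. tuple_scale (f v) v) = 0"
  then have "(\<Sum>i<n. tuple_scale (f (tuple_unit i)) (tuple_unit i)) = 0"
    by (simp add: sum.reindex inj_on_subset[OF inj_tuple_unit])
  then have "(\<lambda>j. if j < n then f (tuple_unit j) else 0) = 0"
    unfolding sum_tuple_unit .
  then have "\<And>j. j < n \<Longrightarrow> f (tuple_unit j) = 0"
    by (auto simp: fun_eq_iff split: if_splits)
  moreover assume "v \<in> tuple_unit ` {..<n}"
  ultimately show "f v = 0" by auto
qed simp

lemma card_tuple_unit: "card ((tuple_unit :: nat \<Rightarrow> nat \<Rightarrow> 'f::real_normed_field) ` {..<n}) = n"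
  by (simp add: card_image inj_on_subset[OF inj_tuple_unit])

lemma max_norm_le_iff: "max_norm n v \<le> c \<longleftrightarrow> 0 \<le> c \<and> (\<forall>i<n. norm (v i) \<le> c)"
  by (auto simp: max_norm_def)

lemma max_norm_less_iff: "max_norm n v < c \<longleftrightarrow> 0 < c \<and> (\<forall>i<n. norm (v i) < c)"
  by (auto simp: max_norm_def)

lemma norm_le_max_norm: "i < n \<Longrightarrow> norm (v i) \<le> max_norm n v"
  by (simp add: max_norm_def)

lemma max_norm_nonneg: "0 \<le> max_norm n v"
  by (simp add: max_norm_def)

lemma max_norm_attained:
  assumes "max_norm n v \<noteq> 0"
  obtains i where "i < n" "norm (v i) = max_norm n v"
proof -
  have "max_norm n v \<in> insert 0 ((\<lambda>i. norm (v i)) ` {..<n})"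
    unfolding max_norm_def by (rule Max_in) auto
  with assms that show thesis by auto
qed

lemma norm_on_max_norm_comp:
  assumes lin: "Vector_Spaces.linear s tuple_scale A" and "inj A" "range A \<subseteq> tuples n"
  shows "norm_on s (\<lambda>x. max_norm n (A x))"
proof -
  have add: "A (x + y) = A x + A y" and scale: "A (s c x) = tuple_scale c (A x)" for x y c
    using lin by (auto simp: Vector_Spaces.linear_iff)
  have A0: "A 0 = 0"
    using add[of 0 0] by simp
  have "max_norm n (A x) = 0 \<longleftrightarrow> x = 0" for x
  proof
    assume 0: "max_norm n (A x) = 0"
    have "A x \<in> tuples n"
      using assms(3) by blast
    then have "A x i = 0" for i
      using norm_le_max_norm[of i n "A x"] 0 by (cases "i < n") (auto simp: tuples_def)
    then have "A x = A 0"
      unfolding A0 by (simp add: fun_eq_iff)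
    then show "x = 0"
      using \<open>inj A\<close> by (simp add: inj_eq)
  next
    assume "x = 0"
    then have "max_norm n (A x) \<le> 0"
      by (simp add: max_norm_le_iff A0)
    then show "max_norm n (A x) = 0"
      using max_norm_nonneg[of n "A x"] by simp
  qed
  moreover have "max_norm n (A (x + y)) \<le> max_norm n (A x) + max_norm n (A y)" for x y
    unfolding max_norm_le_iff add
    by (auto simp: max_norm_nonneg intro!: norm_triangle_le add_mono norm_le_max_norm)
  moreover have "max_norm n (A (s c x)) = norm c * max_norm n (A x)" for c x
  proof -
    \<comment> \<open>Multiplication by \<open>norm c\<close> is monotone, so it commutes with the
      maximum, and it fixes the inserted 0.\<close>
    have "norm c * Max (insert 0 ((\<lambda>i. norm (A x i)) ` {..<n})) =
      Max ((*) (norm c) ` insert 0 ((\<lambda>i. norm (A x i)) ` {..<n}))"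
      by (rule mono_Max_commute) (auto simp: mono_def mult_left_mono)
    then show ?thesis
      by (simp add: max_norm_def scale tuple_scale_def norm_mult image_image)
  qed
  ultimately show ?thesis
    by (simp add: norm_on_def max_norm_nonneg)
qed

section \<open>Euclidean coordinates, small steps into a ball and dimension counts\<close>

text \<open>
  \<open>cj\<close> abstracts the identity of the reals and the conjugation of the complex numbers.
\<close>

locale inner_coords = finite_dimensional_vector_space scale Basis
  for scale :: "'f::{real_normed_field,heine_borel} \<Rightarrow> 'a::ab_group_add \<Rightarrow> 'a" (infixr \<open>\<odot>\<close> 75)
    and Basis :: "'a set" +
  fixes cj :: "'f \<Rightarrow> 'f"
  assumes cj_add: "cj (a + b) = cj a + cj b"
    and cj_mult: "cj (a * b) = cj a * cj b"
    and cj_cj [simp]: "cj (cj a) = a"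
    and mult_cj: "a * cj a = of_real ((norm a)\<^sup>2)"
begin

definition coord :: "'a \<Rightarrow> 'a \<Rightarrow> 'f" where
  "coord x b = representation Basis x b"

text \<open>The inner product for which \<open>Basis\<close> is orthonormal, linear in the first
  argument.\<close>

definition H :: "'a \<Rightarrow> 'a \<Rightarrow> 'f" where
  "H x y = (\<Sum>b\<in>Basis. coord x b * cj (coord y b))"

text \<open>The squared Euclidean length; without the root, Pythagoras is a plain sum.\<close>

definition E :: "'a \<Rightarrow> real" where
  "E x = (\<Sum>b\<in>Basis. (norm (coord x b))\<^sup>2)"

lemma coord_add: "coord (x + y) b = coord x b + coord y b"
  by (simp add: coord_def representation_add independent_Basis span_Basis)

lemma coord_scale: "coord (c \<odot> x) b = c * coord x b"
  by (simp add: coord_def representation_scale independent_Basis span_Basis)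

lemma coord_diff: "coord (x - y) b = coord x b - coord y b"
  using coord_add[of "x - y" y] by (simp add: algebra_simps)

lemma coord_expand: "(\<Sum>b\<in>Basis. coord x b \<odot> b) = x"
  unfolding coord_def
  by (rule sum_representation_eq) (simp_all add: independent_Basis span_Basis finite_Basis)

lemma coord_sum: "b \<in> Basis \<Longrightarrow> coord (\<Sum>b\<in>Basis. v b \<odot> b) b = v b"
proof -
  assume b: "b \<in> Basis"
  have "coord (\<Sum>b\<in>Basis. v b \<odot> b) b = (\<Sum>c\<in>Basis. coord (v c \<odot> c) b)"
    unfolding coord_def by (subst representation_sum) (auto simp: independent_Basis span_Basis)
  also have "\<dots> = (\<Sum>c\<in>Basis. if c = b then v b else 0)"
    unfolding coord_scale
    by (rule sum.cong) (auto simp: coord_def representation_basis independent_Basis)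
  finally show ?thesis
    using b finite_Basis by simp
qed

lemma cj_0 [simp]: "cj 0 = 0"
  using cj_add[of 0 0] by simp

lemma cj_sum: "finite I \<Longrightarrow> cj (\<Sum>i\<in>I. g i) = (\<Sum>i\<in>I. cj (g i))"
  by (induction I rule: finite_induct) (auto simp: cj_add)

lemma H_add_left: "H (x + y) z = H x z + H y z"
  by (simp add: H_def coord_add algebra_simps sum.distrib)

lemma H_scale_left: "H (c \<odot> x) z = c * H x z"
  by (simp add: H_def coord_scale sum_distrib_left mult.assoc)

lemma H_cj: "cj (H x y) = H y x"
  by (simp add: H_def cj_sum finite_Basis cj_mult mult.commute)

lemma H_add_right: "H z (x + y) = H z x + H z y"
  unfolding H_cj[of _ z, symmetric] H_add_left cj_add ..

lemma H_scale_right: "H z (c \<odot> x) = cj c * H z x"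
  unfolding H_cj[of _ z, symmetric] H_scale_left cj_mult ..

lemma H_self: "H x x = of_real (E x)"
  by (simp add: H_def E_def mult_cj)

lemma H_linear: "Vector_Spaces.linear scale (*) (\<lambda>x. H x u)"
  unfolding Vector_Spaces.linear_iff
  by (auto simp: H_add_left H_scale_left vector_space_axioms intro!: vector_space.intro)
    (auto simp: algebra_simps)

lemma E_nonneg [simp]: "0 \<le> E x"
  by (simp add: E_def sum_nonneg)

lemma E_eq_0_iff [simp]: "E x = 0 \<longleftrightarrow> x = 0"
proof
  assume "E x = 0"
  then have "\<forall>b\<in>Basis. coord x b = 0"
    by (simp add: E_def sum_nonneg_eq_0_iff finite_Basis)
  then show "x = 0"
    using coord_expand[of x] by simp
qed (simp add: E_def coord_def representation_zero)

lemma E_pos_iff [simp]: "0 < E x \<longleftrightarrow> x \<noteq> 0"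
  using E_nonneg[of x] E_eq_0_iff[of x] by linarith

lemma E_scale: "E (c \<odot> x) = (norm c)\<^sup>2 * E x"
  by (simp add: E_def coord_scale norm_mult power_mult_distrib sum_distrib_left)

lemma E_pythagoras:
  assumes "H z u = 0"
  shows "E (u + z) = E u + E z"
proof -
  have "H u z = 0"
    using assms H_cj[of z u] by simp
  then have "of_real (E (u + z)) = (of_real (E u + E z) :: 'f)"
    using assms by (simp add: H_self[symmetric] H_add_left H_add_right)
  then show ?thesis
    unfolding of_real_eq_iff .
qed

text \<open>A tangential move \<open>z\<close> of first order changes the squared length only to
  second order, while the inward component along \<open>u\<close> lowers it to first order. A small
  \<open>t\<close> therefore leads into the open ball.\<close>

lemma E_small_step:
  assumes u: "u \<noteq> 0" and z: "H z u = 0" and d: "\<delta> > 0"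
  obtains t where "t > 0" "E (of_real (1 - t * \<delta>) \<odot> u + of_real t \<odot> z) < E u"
proof -
  define D where "D = \<delta>\<^sup>2 * E u + E z"
  \<comment> \<open>The minimiser of the quadratic
    \<open>E u - 2 * t * (\<delta> * E u) + t * (t * D)\<close>.\<close>
  define t where "t = \<delta> * E u / D"
  have D: "D > 0"
    using u d unfolding D_def by (intro add_pos_nonneg) auto
  then have t: "t > 0"
    using u d by (simp add: t_def)
  have "H (of_real t \<odot> z) (of_real (1 - t * \<delta>) \<odot> u) = 0"
    using z by (simp add: H_scale_left H_scale_right)
  then have "E (of_real (1 - t * \<delta>) \<odot> u + of_real t \<odot> z) = (1 - t * \<delta>)\<^sup>2 * E u + t\<^sup>2 * E z"
    by (simp add: E_pythagoras E_scale del: of_real_diff of_real_mult)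
  also have "\<dots> = E u - 2 * t * (\<delta> * E u) + t * (t * D)"
    by (simp add: D_def power2_eq_square algebra_simps)
  also have "t * D = \<delta> * E u"
    using D by (simp add: t_def)
  also have "E u - 2 * t * (\<delta> * E u) + t * (\<delta> * E u) < E u"
    using t d u by simp
  finally show thesis
    using that t by blast
qed

text \<open>The image of \<open>Basis\<close> is an independent set in a space spanned by
  \<open>n\<close> unit tuples. If it already has \<open>n\<close> elements, a tuple outside its
  span could be adjoined and would break this bound.\<close>

lemma dim_le_tuples:
  assumes lin: "Vector_Spaces.linear scale tuple_scale A" and inj: "inj A" and sub: "range A \<subseteq> tuples n"
  shows "card Basis \<le> n" and "card Basis = n \<Longrightarrow> range A = tuples n"
proof -
  interpret A: Vector_Spaces.linear scale tuple_scale A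
    by (rule lin)
  have ind: "tuple.independent (A ` Basis)"
    by (rule A.independent_injective_image[OF independent_Basis])
      (use inj in \<open>auto intro: inj_on_subset\<close>)
  have card: "card (A ` Basis) = card Basis"
    using inj by (intro card_image) (auto intro: inj_on_subset)
  have bound: "card S \<le> n" if "tuple.independent S" "S \<subseteq> tuples n" for S :: "(nat \<Rightarrow> 'f) set"
    using tuple.independent_span_bound[of "tuple_unit ` {..<n}" S] that card_tuple_unit[where ?'f = 'f, of n]
    by (simp add: span_tuple_unit)
  show le: "card Basis \<le> n"
    using bound[OF ind] sub card by auto
  assume n: "card Basis = n"
  have "tuples n \<subseteq> tuple.span (A ` Basis)"
  proof (rule subsetI, rule ccontr)
    fix v :: "nat \<Rightarrow> 'f"
    assume v: "v \<in> tuples n" "v \<notin> tuple.span (A ` Basis)"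
    then have "v \<notin> A ` Basis"
      using tuple.span_base by blast
    moreover have "card (insert v (A ` Basis)) \<le> n"
      using v sub by (intro bound tuple.independent_insertI ind) auto
    ultimately show False
      using card n finite_Basis by simp
  qed
  also have "\<dots> = range A"
    by (simp add: A.span_image span_Basis)
  finally show "range A = tuples n"
    using sub by simp
qed

text \<open>The \<open>n\<close> independent unit tuples lie in the span of the image of
  \<open>Basis\<close>.\<close>

lemma tuples_le_dim:
  assumes lin: "Vector_Spaces.linear scale tuple_scale A" and sup: "tuples n \<subseteq> range A"
  shows "n \<le> card Basis"
proof -
  interpret A: Vector_Spaces.linear scale tuple_scale A
    by (rule lin)
  have "tuple_unit ` {..<n} \<subseteq> tuple.span (A ` Basis)"
    using sup tuple_unit_in_tuples by (auto simp: A.span_image span_Basis)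
  then have "card ((tuple_unit :: nat \<Rightarrow> nat \<Rightarrow> 'f) ` {..<n}) \<le> card (A ` Basis)"
    using tuple.independent_span_bound[OF finite_imageI[OF finite_Basis] independent_tuple_unit] by blast
  then show ?thesis
    using card_image_le[OF finite_Basis, of A] by (simp add: card_tuple_unit)
qed

text \<open>Pulling the maximum norm back along the coordinates gives the norm with which a minimal
  one is compared.\<close>

lemma exists_max_norm: "\<exists>M. norm_on scale M \<and> isometric_to_max_norm scale M"
proof -
  obtain h where h: "bij_betw h {..<card Basis} Basis"
    using ex_bij_betw_nat_finite[OF finite_Basis] by (auto simp: atLeast0LessThan)
  define A where "A x = (\<lambda>i. if i < card Basis then coord x (h i) else 0)" for x
  have lin: "Vector_Spaces.linear scale tuple_scale A"
    unfolding Vector_Spaces.linear_iff A_def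
    by (auto simp: vector_space_axioms tuple.vector_space_axioms coord_add coord_scale
        tuple_scale_def fun_eq_iff)
  have "inj A"
  proof (rule injI)
    fix x y assume eq: "A x = A y"
    have "coord x b = coord y b" if b: "b \<in> Basis" for b
    proof -
      obtain i where "i \<in> {..<card Basis}" "b = h i"
        using h b unfolding bij_betw_def by blast
      then show ?thesis
        using fun_cong[OF eq, of i] by (simp add: A_def)
    qed
    then have "(\<Sum>b\<in>Basis. coord x b \<odot> b) = (\<Sum>b\<in>Basis. coord y b \<odot> b)"
      by simp
    then show "x = y"
      by (simp only: coord_expand)
  qed
  moreover have sub: "range A \<subseteq> tuples (card Basis)"
    by (auto simp: A_def tuples_def)
  moreover have "bij_betw A UNIV (tuples (card Basis))"
    using dim_le_tuples(2)[OF lin \<open>inj A\<close> sub] \<open>inj A\<close> by (simp add: bij_betw_def)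
  ultimately show ?thesis
    using norm_on_max_norm_comp[OF lin] lin unfolding isometric_to_max_norm_def by blast
qed

end

section \<open>Smooth points where a Euclidean ball touches the unit sphere\<close>

locale normed_coords = inner_coords scale Basis cj + norm_space scale N
  for scale :: "'f::{real_normed_field,heine_borel} \<Rightarrow> 'a::ab_group_add \<Rightarrow> 'a" (infixr \<open>\<odot>\<close> 75)
    and Basis cj N
begin

text \<open>
  The Euclidean ball around \<open>p\<close> through \<open>q\<close> lies in the unit ball of \<open>N\<close> and touches its sphere
  at \<open>q\<close>, so a hyperplane supporting the unit ball at \<open>q\<close> also supports the Euclidean ball.
\<close>

definition touching :: "'a \<Rightarrow> 'a \<Rightarrow> bool" where
  "touching p q \<longleftrightarrow> N p < 1 \<and> N q = 1 \<and> (\<forall>y. E (y - p) < E (q - p) \<longrightarrow> N y < 1)"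

text \<open>The kernel consists of the tangent directions at \<open>q\<close> of the Euclidean
  sphere around \<open>p\<close>; the denominator normalises the value at \<open>q\<close> to
  1.\<close>

definition touch_functional :: "'a \<Rightarrow> 'a \<Rightarrow> 'a \<Rightarrow> 'f" where
  "touch_functional p q x = H x (q - p) / H q (q - p)"

lemma touching_neq: "touching p q \<Longrightarrow> q - p \<noteq> 0"
  by (auto simp: touching_def)

lemma touchingD: "touching p q \<Longrightarrow> E (y - p) < E (q - p) \<Longrightarrow> N y < 1"
  by (simp add: touching_def)

lemma touching_norm: "touching p q \<Longrightarrow> N q = 1"
  by (simp add: touching_def)

text \<open>If \<open>N (q + z) < 1\<close> for a tangent direction \<open>z\<close>, then
  \<open>q\<close> is a convex combination of a point of the closed unit ball beyond
  \<open>q + z\<close> and a point of the open Euclidean ball on the opposite side. The latter has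
  norm below 1, which contradicts \<open>N q = 1\<close>.\<close>

lemma touching_kernel_bj:
  assumes t: "touching p q" and z: "H z (q - p) = 0"
  shows "1 \<le> N (q + z)"
proof (rule ccontr)
  assume "\<not> 1 \<le> N (q + z)"
  define u where "u = q - p"
  have u: "u \<noteq> 0"
    using touching_neq[OF t] by (simp add: u_def)
  \<comment> \<open>With this choice \<open>N (\<delta> u)\<close> is exactly the slack
    \<open>1 - N (q + z)\<close>, so \<open>q + z\<close> may be pushed outwards by
    \<open>\<delta> u\<close> without leaving the closed unit ball.\<close>
  define \<delta> where "\<delta> = (1 - N (q + z)) / N u"
  have \<delta>: "\<delta> > 0"
    using u \<open>\<not> 1 \<le> N (q + z)\<close> by (simp add: \<delta>_def)
  have far: "N (q + z + of_real \<delta> \<odot> u) \<le> 1"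
  proof -
    have "N (of_real \<delta> \<odot> u) = \<delta> * N u"
      using \<delta> by (simp add: N_scale)
    also have "\<dots> = 1 - N (q + z)"
      using u by (simp add: \<delta>_def)
    finally show ?thesis
      using N_triangle[of "q + z" "of_real \<delta> \<odot> u"] by linarith
  qed
  have "H (- z) u = 0"
    using z H_scale_left[of "-1" z u] by (simp add: u_def)
  then obtain r where r: "r > 0"
    and small: "E (of_real (1 - r * \<delta>) \<odot> u + of_real r \<odot> (- z)) < E u"
    using E_small_step[OF u _ \<delta>] by blast
  \<comment> \<open>The point \<open>w\<close> equals \<open>q - r (z + \<delta> u)\<close>: it
    continues the segment from \<open>q + z + \<delta> u\<close> through \<open>q\<close> and enters
    the Euclidean ball.\<close>
  define w where "w = p + of_real (1 - r * \<delta>) \<odot> u + of_real r \<odot> (- z)"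
  have "N w < 1"
    by (rule touchingD[OF t]) (use small in \<open>simp add: w_def u_def add.assoc\<close>)
  have "w + of_real r \<odot> (q + z + of_real \<delta> \<odot> u) = of_real (1 + r) \<odot> q"
    by (simp add: w_def u_def algebra_simps scale_right_distrib scale_left_distrib)
  then have "(1 + r) * N q \<le> N w + r * N (q + z + of_real \<delta> \<odot> u)"
    using N_triangle[of w "of_real r \<odot> (q + z + of_real \<delta> \<odot> u)"] r
    by (simp add: N_scale del: of_real_add)
  moreover have "r * N (q + z + of_real \<delta> \<odot> u) \<le> r * 1"
    using far r by (intro mult_left_mono) auto
  ultimately show False
    using \<open>N w < 1\<close> touching_norm[OF t] by simp
qed

text \<open>A direction that is not tangent has, after scaling, an inward component. A short move
  from \<open>q\<close> along it enters the Euclidean ball and so lowers \<open>N\<close> below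
  \<open>N q\<close>.\<close>

lemma touching_bj_kernel:
  assumes t: "touching p q" and y: "bj_orthogonal scale N q y"
  shows "H y (q - p) = 0"
proof (rule ccontr)
  define u where "u = q - p"
  define h where "h = H y u"
  assume "H y (q - p) \<noteq> 0"
  then have h: "h \<noteq> 0"
    by (simp add: h_def u_def)
  have u: "u \<noteq> 0"
    using touching_neq[OF t] by (simp add: u_def)
  \<comment> \<open>This scalar makes \<open>c y + u\<close> tangent, so that \<open>c y\<close> is
    the inward vector \<open>- u\<close> plus a tangent vector.\<close>
  define c where "c = - of_real (E u) / h"
  have "H (c \<odot> y + u) u = c * h + of_real (E u)"
    by (simp only: H_add_left H_scale_left H_self h_def)
  then have "H (c \<odot> y + u) u = 0"
    using h by (simp add: c_def)
  then obtain r where r: "r > 0"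
    and small: "E (of_real (1 - r * 1) \<odot> u + of_real r \<odot> (c \<odot> y + u)) < E u"
    using E_small_step[OF u _ zero_less_one] by blast
  have "of_real (1 - r * 1) \<odot> u + of_real r \<odot> (c \<odot> y + u) = q + (of_real r * c) \<odot> y - p"
    by (simp add: u_def algebra_simps scale_right_distrib scale_left_distrib)
  then have "N (q + (of_real r * c) \<odot> y) < 1"
    using touchingD[OF t] small by (simp add: u_def)
  then show False
    using y touching_norm[OF t] by (simp add: bj_orthogonal_def not_less[symmetric])
qed

context
  fixes p q
  assumes t: "touching p q"
begin

text \<open>Otherwise \<open>- q\<close> would be a tangent direction, and the kernel bound would
  read \<open>1 \<le> N (q - q)\<close>.\<close>

lemma H_touching_neq_0: "H q (q - p) \<noteq> 0"
proof
  assume "H q (q - p) = 0"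
  then have "H (- q) (q - p) = 0"
    using H_scale_left[of "-1" q] by simp
  from touching_kernel_bj[OF t this] show False by simp
qed

lemma touch_functional_self [simp]: "touch_functional p q q = 1"
  using H_touching_neq_0 by (simp add: touch_functional_def)

lemma touch_functional_linear: "Vector_Spaces.linear scale (*) (touch_functional p q)"
  using H_linear[of "q - p"]
  unfolding Vector_Spaces.linear_iff touch_functional_def by (simp add: add_divide_distrib)

text \<open>After scaling \<open>y\<close> to value 1, its difference from \<open>q\<close> is
  tangent, so the kernel bound says that the scaled vector has norm at least 1.\<close>

lemma touch_functional_le: "norm (touch_functional p q y) \<le> N y"
proof (cases "touch_functional p q y = 0")
  case False
  define f where "f = touch_functional p q"
  have f: "f y \<noteq> 0"
    using False by (simp add: f_def)
  have "H (inverse (f y) \<odot> y + (-1) \<odot> q) (q - p) = 0"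
    unfolding H_add_left H_scale_left
    using f H_touching_neq_0 by (simp add: f_def touch_functional_def)
  from touching_kernel_bj[OF t this] have "1 \<le> N (inverse (f y) \<odot> y)"
    by simp
  then have "1 \<le> N y / norm (f y)"
    unfolding N_scale norm_inverse by (simp add: divide_simps)
  then show ?thesis
    using f by (simp add: f_def)
qed simp

lemma touching_bj_iff: "bj_orthogonal scale N q y \<longleftrightarrow> touch_functional p q y = 0"
proof
  assume "touch_functional p q y = 0"
  then have "H (c \<odot> y) (q - p) = 0" for c
    using H_touching_neq_0 by (simp add: touch_functional_def H_scale_left)
  then show "bj_orthogonal scale N q y"
    using touching_kernel_bj[OF t] touching_norm[OF t] by (simp add: bj_orthogonal_def)
qed (simp add: touching_bj_kernel[OF t] touch_functional_def)

text \<open>The kernel of any supporting functional at \<open>q\<close> is orthogonal to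
  \<open>q\<close>, hence lies in the kernel of the touching functional. Both functionals are 1 at
  \<open>q\<close>, so they agree.\<close>

lemma touching_smooth: "smooth_vector scale N q"
proof -
  have q: "q \<noteq> 0"
    using touching_norm[OF t] by auto
  have sup: "supporting_functional scale N q (touch_functional p q)"
    using touch_functional_linear touch_functional_le touching_norm[OF t]
    by (simp add: supporting_functional_iff[OF q])
  have "g = touch_functional p q" if "supporting_functional scale N q g" for g
  proof
    fix x
    have lin: "g (x + y) = g x + g y" "g (c \<odot> x) = c * g x" for x y c
      using that
      by (auto simp: supporting_functional_iff[OF q] Vector_Spaces.linear_iff)
    have le: "norm (g y) \<le> N y" and gq: "g q = 1" for y
      using that touching_norm[OF t]
      by (auto simp: supporting_functional_iff[OF q])
    \<comment> \<open>The projection of \<open>x\<close> onto the kernel of \<open>g\<close> along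
      \<open>q\<close>.\<close>
    define z where "z = x + (- g x) \<odot> q"
    have "g z = 0"
      by (simp add: z_def lin gq del: scale_minus_left)
    then have "norm (g (q + c \<odot> z)) = 1" for c
      by (simp add: lin gq)
    then have "bj_orthogonal scale N q z"
      using le touching_norm[OF t] unfolding bj_orthogonal_def by metis
    then have "touch_functional p q z = 0"
      by (simp add: touching_bj_iff)
    then show "g x = touch_functional p q x"
      using touch_functional_linear
      by (simp add: z_def Vector_Spaces.linear_iff del: scale_minus_left)
  qed
  with sup q show ?thesis
    unfolding smooth_vector_def by blast
qed

end

section \<open>Existence of touching points by compactness\<close>

text \<open>The vector type carries no topology, so continuity is expressed on coordinate functions
  in the product topology. The difference of norms is at most the sum of the coordinate differences
  weighted by \<open>N b\<close>.\<close>

lemma continuous_on_N_coords: "continuous_on UNIV (\<lambda>v. N (\<Sum>b\<in>Basis. v b \<odot> b))"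
proof -
  have "((\<lambda>w. N (\<Sum>b\<in>Basis. w b \<odot> b)) \<longlongrightarrow> N (\<Sum>b\<in>Basis. v b \<odot> b)) (at v)" for v
  proof -
    define g where "g w = (\<Sum>b\<in>Basis. norm (w b - v b) * N b)" for w :: "'a \<Rightarrow> 'f"
    have bound: "\<bar>N (\<Sum>b\<in>Basis. w b \<odot> b) - N (\<Sum>b\<in>Basis. v b \<odot> b)\<bar> \<le> g w" for w
    proof -
      let ?x = "\<Sum>b\<in>Basis. w b \<odot> b" and ?y = "\<Sum>b\<in>Basis. v b \<odot> b"
      have "N (?x - ?y) \<le> g w"
        using N_sum[OF finite_Basis, of "\<lambda>b. (w b - v b) \<odot> b"]
        unfolding g_def N_scale by (simp add: scale_left_diff_distrib sum_subtractf)
      then show ?thesis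
        using N_triangle_sub[of ?x ?y] N_triangle_sub[of ?y ?x] N_minus_commute[of ?x ?y]
        by linarith
    qed
    have "continuous_on UNIV g"
      unfolding g_def by (intro continuous_intros continuous_on_product_coordinates)
    then have "(g \<longlongrightarrow> g v) (at v)"
      by (simp add: continuous_on_def)
    then have "(g \<longlongrightarrow> 0) (at v)"
      by (simp add: g_def)
    then have "((\<lambda>w. N (\<Sum>b\<in>Basis. w b \<odot> b) - N (\<Sum>b\<in>Basis. v b \<odot> b)) \<longlongrightarrow> 0) (at v)"
      by (rule Lim_null_comparison[rotated]) (simp add: bound)
    then show ?thesis
      by (rule LIM_zero_cancel)
  qed
  then show ?thesis
    by (simp add: continuous_on_def)
qed

text \<open>The given \<open>x\<close> is a competitor, so only points at most as far from
  \<open>p\<close> matter; their coordinates range over a compact set.\<close>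

lemma nearest_point:
  assumes x: "N x = 1"
  obtains q where "1 \<le> N q" "E (q - p) \<le> E (x - p)"
    "\<And>y. 1 \<le> N y \<Longrightarrow> E (q - p) \<le> E (y - p)"
proof -
  define vec where "vec v = (\<Sum>b\<in>Basis. v b \<odot> b)" for v
  define \<rho> where "\<rho> = sqrt (E (x - p))"
  \<comment> \<open>A product of compact closed balls. Indices outside \<open>Basis\<close> are
    frozen at 0, which keeps the product over all vectors compact.\<close>
  define V where "V = Pi\<^sub>E UNIV (\<lambda>b. if b \<in> Basis then cball (coord p b) \<rho> else {0})"
  define S where "S = V \<inter> {v. 1 \<le> N (vec v)}"
  define res where "res y = (\<lambda>b. if b \<in> Basis then coord y b else 0)" for y
  have vec_res: "vec (res y) = y" for y
    using coord_expand[of y] by (simp add: vec_def res_def cong: sum.cong)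
  have E_vec: "E (vec v - p) = (\<Sum>b\<in>Basis. (norm (v b - coord p b))\<^sup>2)" for v
    by (simp add: E_def coord_diff vec_def coord_sum cong: sum.cong)
  have res_S: "res y \<in> S" if "1 \<le> N y" "E (y - p) \<le> E (x - p)" for y
  proof -
    have "norm (coord y b - coord p b) \<le> \<rho>" if b: "b \<in> Basis" for b
    proof -
      have "(norm (coord (y - p) b))\<^sup>2 \<le> E (y - p)"
        unfolding E_def by (rule member_le_sum) (use b finite_Basis in auto)
      then show ?thesis
        using \<open>E (y - p) \<le> E (x - p)\<close> unfolding \<rho>_def coord_diff by (intro real_le_rsqrt) simp
    qed
    then have "res y \<in> V"
      by (auto simp: V_def res_def dist_norm norm_minus_commute)
    with that show ?thesis
      by (simp add: S_def vec_res)
  qed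
  have "compactin (product_topology (\<lambda>_. euclidean) UNIV) V"
    unfolding V_def compactin_PiE by (simp add: compactin_euclidean_iff)
  then have "compact V"
    by (simp add: euclidean_product_topology compactin_euclidean_iff)
  moreover have "closed {v. 1 \<le> N (vec v)}"
    unfolding vec_def by (intro closed_Collect_le continuous_on_N_coords continuous_intros)
  ultimately have "compact S"
    unfolding S_def by (rule compact_Int_closed)
  moreover have "S \<noteq> {}"
    using res_S[of x] x by auto
  moreover have "continuous_on S (\<lambda>v. E (vec v - p))"
    unfolding E_vec
    by (intro continuous_intros continuous_on_subset[OF continuous_on_product_coordinates]) auto
  ultimately obtain v where v: "v \<in> S" and min: "\<And>w. w \<in> S \<Longrightarrow> E (vec v - p) \<le> E (vec w - p)"
    using continuous_attains_inf[of S "\<lambda>v. E (vec v - p)"] by blast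
  have le: "E (vec v - p) \<le> E (x - p)"
    using min[OF res_S[of x]] x by (simp add: vec_res)
  show thesis
  proof
    show "1 \<le> N (vec v)"
      using v by (simp add: S_def)
    \<comment> \<open>A point farther from \<open>p\<close> than \<open>x\<close> need not lie in
      \<open>S\<close>; it loses against \<open>x\<close> itself.\<close>
    show "E (vec v - p) \<le> E (y - p)" if "1 \<le> N y" for y
      using min[OF res_S[of y]] le that by (cases "E (y - p) \<le> E (x - p)") (auto simp: vec_res)
  qed (rule le)
qed

text \<open>A nearest point with \<open>N q > 1\<close> could be moved a little towards
  \<open>p\<close>: it would stay outside the open unit ball and come strictly closer.\<close>

lemma touching_exists:
  assumes x: "N x = 1" and p: "N p < 1"
  obtains q where "touching p q" "E (q - p) \<le> E (x - p)"
proof -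
  obtain q where q: "1 \<le> N q" "E (q - p) \<le> E (x - p)"
    and min: "\<And>y. 1 \<le> N y \<Longrightarrow> E (q - p) \<le> E (y - p)"
    using nearest_point[OF x] by blast
  have "q - p \<noteq> 0"
    using q p by auto
  have "N q = 1"
  proof (rule ccontr)
    assume "N q \<noteq> 1"
    then have gt: "N q > 1"
      using q by simp
    define d where "d = N (q - p)"
    have d: "d > 0"
      using \<open>q - p \<noteq> 0\<close> unfolding d_def N_pos_iff .
    \<comment> \<open>The summand \<open>d\<close> in the denominator makes \<open>r < 1\<close>,
      and the other summand only shrinks \<open>r\<close>, so the loss \<open>r * d\<close> stays
      within \<open>N q - 1\<close>.\<close>
    define r where "r = (N q - 1) / (N q - 1 + d)"
    have r: "0 < r" "r < 1"
      using gt d by (auto simp: r_def)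
    have "r \<le> (N q - 1) / d"
      unfolding r_def using gt d by (intro divide_left_mono) auto
    then have rd: "r * d \<le> N q - 1"
      using d by (simp add: field_simps)
    define y where "y = q - of_real r \<odot> (q - p)"
    have "N y \<ge> N q - N (of_real r \<odot> (q - p))"
      unfolding y_def using N_triangle_sub[of q "of_real r \<odot> (q - p)"] .
    also have "N (of_real r \<odot> (q - p)) = r * d"
      using r by (simp add: N_scale d_def)
    finally have "1 \<le> N y"
      using rd by simp
    have "y - p = of_real (1 - r) \<odot> (q - p)"
      by (simp add: y_def scale_left_diff_distrib algebra_simps)
    then have "E (y - p) = (1 - r)\<^sup>2 * E (q - p)"
      by (simp add: E_scale del: of_real_diff)
    also have "\<dots> < 1 * E (q - p)"
      using r \<open>q - p \<noteq> 0\<close> by (intro mult_strict_right_mono) (auto simp: power_less_one_iff)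
    finally show False
      using min[OF \<open>1 \<le> N y\<close>] by simp
  qed
  moreover have "N y < 1" if "E (y - p) < E (q - p)" for y
    using min[of y] that by (meson not_le)
  ultimately show thesis
    using that q p by (auto simp: touching_def)
qed

section \<open>Touching functionals norm the space\<close>

text \<open>Each coordinate is bounded by the Euclidean length. This turns Euclidean closeness of a
  touching point into closeness in \<open>N\<close>.\<close>

lemma N_le_E: "N y \<le> (\<Sum>b\<in>Basis. N b) * sqrt (E y)"
proof -
  have "N y \<le> (\<Sum>b\<in>Basis. N (coord y b \<odot> b))"
    using N_sum[OF finite_Basis, of "\<lambda>b. coord y b \<odot> b"] by (simp add: coord_expand)
  also have "\<dots> \<le> (\<Sum>b\<in>Basis. N b * sqrt (E y))"
  proof (rule sum_mono)
    fix b assume b: "b \<in> Basis"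
    have "(norm (coord y b))\<^sup>2 \<le> E y"
      unfolding E_def by (rule member_le_sum) (use b finite_Basis in auto)
    then have "norm (coord y b) \<le> sqrt (E y)"
      by (rule real_le_rsqrt)
    then show "N (coord y b \<odot> b) \<le> N b * sqrt (E y)"
      by (simp add: N_scale mult.commute mult_left_mono)
  qed
  finally show ?thesis
    by (simp add: sum_distrib_right)
qed

text \<open>Take \<open>p\<close> just inside the sphere on the ray to \<open>x\<close>. The
  touching point \<open>q\<close> is no farther from \<open>p\<close> than \<open>x\<close> is,
  hence close to \<open>x\<close>, and a functional bounded by \<open>N\<close> that is 1 at
  \<open>q\<close> is nearly 1 at \<open>x\<close>.\<close>

lemma touching_norming_unit:
  assumes x: "N x = 1" and \<epsilon>: "\<epsilon> > 0"
  obtains p q where "touching p q" "1 - \<epsilon> \<le> norm (touch_functional p q x)"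
proof -
  \<comment> \<open>The sum bounds \<open>N (q - p)\<close> up to the factor \<open>\<eta>\<close>;
    the added 1 accounts for \<open>N (x - p) = \<eta>\<close>.\<close>
  define C where "C = (\<Sum>b\<in>Basis. N b) * sqrt (E x) + 1"
  have C: "C \<ge> 1"
    by (simp add: C_def sum_nonneg)
  define \<eta> where "\<eta> = min 1 (\<epsilon> / C)"
  have \<eta>: "0 < \<eta>" "\<eta> \<le> 1" "\<eta> * C \<le> \<epsilon>"
    using C \<epsilon> by (auto simp: \<eta>_def min_def divide_simps mult.commute)
  define p where "p = of_real (1 - \<eta>) \<odot> x"
  have xp: "x - p = of_real \<eta> \<odot> x"
    by (simp add: p_def scale_left_diff_distrib)
  have "N p < 1"
    using \<eta> x unfolding p_def N_scale norm_of_real by simp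
  then obtain q where t: "touching p q" and "E (q - p) \<le> E (x - p)"
    using touching_exists[OF x] by blast
  then have "sqrt (E (q - p)) \<le> \<eta> * sqrt (E x)"
    using \<eta> by (simp add: xp E_scale real_sqrt_mult[symmetric] real_le_lsqrt power_mult_distrib)
  then have "(\<Sum>b\<in>Basis. N b) * sqrt (E (q - p)) \<le> (\<Sum>b\<in>Basis. N b) * (\<eta> * sqrt (E x))"
    by (intro mult_left_mono) (auto simp: sum_nonneg)
  then have "N (q - p) \<le> (\<Sum>b\<in>Basis. N b) * (\<eta> * sqrt (E x))"
    using N_le_E[of "q - p"] by linarith
  moreover have "N (x - p) = \<eta>"
    using \<eta> x by (simp add: xp N_scale)
  moreover have "N (q - x) \<le> N (q - p) + N (x - p)"
    using N_triangle[of "q - p" "p - x"] N_minus_commute[of x p] by simp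
  ultimately have "N (q - x) \<le> \<eta> * C"
    by (simp add: C_def algebra_simps)
  then have d: "norm (touch_functional p q (q - x)) \<le> \<epsilon>"
    using touch_functional_le[OF t, of "q - x"] \<eta> by linarith
  have "touch_functional p q (q - x) + touch_functional p q x = 1"
    using touch_functional_linear[OF t] touch_functional_self[OF t]
    unfolding Vector_Spaces.linear_iff by (metis diff_add_cancel)
  then have "1 \<le> norm (touch_functional p q (q - x)) + norm (touch_functional p q x)"
    using norm_triangle_ineq[of "touch_functional p q (q - x)" "touch_functional p q x"] by simp
  with d t show thesis
    by (intro that) auto
qed

section \<open>From finitely many neighbourhoods to finitely many norming functionals\<close>

lemma touching_out_nbhd:
  assumes "touching p q"
  shows "out_nbhd scale N (line scale q) = {line scale y | y. y \<noteq> 0 \<and> touch_functional p q y = 0}"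
    and "out_nbhd scale N (line scale q) \<in> smooth_out_nbhds scale N"
proof -
  have "q \<noteq> 0"
    using touching_norm[OF assms] by auto
  then show "out_nbhd scale N (line scale q) = {line scale y | y. y \<noteq> 0 \<and> touch_functional p q y = 0}"
    by (rule out_nbhd_line_eqI) (rule touching_bj_iff[OF assms])
  show "out_nbhd scale N (line scale q) \<in> smooth_out_nbhds scale N"
    using touching_smooth[OF assms] by (auto simp: smooth_out_nbhds_eq)
qed

text \<open>A common neighbourhood means a common kernel, so the second functional is the first
  times its own value at \<open>q\<close>, which has modulus at most \<open>N q = 1\<close>.\<close>

lemma touch_functional_norm_le:
  assumes t: "touching p q" "touching p' q'"
    and eq: "out_nbhd scale N (line scale q) = out_nbhd scale N (line scale q')"
  shows "norm (touch_functional p' q' x) \<le> norm (touch_functional p q x)"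
proof -
  define c where "c = touch_functional p q x"
  define z where "z = x + (- c) \<odot> q"
  note lin = touch_functional_linear[OF t(1)] touch_functional_linear[OF t(2)]
  have q: "q \<noteq> 0" "q' \<noteq> 0"
    using t touching_norm by fastforce+
  have "touch_functional p q z = 0"
    using lin(1) touch_functional_self[OF t(1)]
    by (simp add: z_def c_def Vector_Spaces.linear_iff del: scale_minus_left)
  then have "bj_orthogonal scale N q z"
    by (simp add: touching_bj_iff[OF t(1)])
  \<comment> \<open>The neighbourhoods contain only lines of nonzero vectors, so
    \<open>z = 0\<close> is a separate case.\<close>
  then have "bj_orthogonal scale N q' z"
    using line_in_out_nbhd_iff[OF q(1), of z] line_in_out_nbhd_iff[OF q(2), of z] eq
    by (cases "z = 0") (auto simp: bj_orthogonal_def)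
  then have "touch_functional p' q' z = 0"
    by (simp add: touching_bj_iff[OF t(2)])
  then have "touch_functional p' q' x = c * touch_functional p' q' q"
    using lin(2) by (simp add: z_def Vector_Spaces.linear_iff del: scale_minus_left)
  moreover have "norm c * norm (touch_functional p' q' q) \<le> norm c * 1"
    using touch_functional_le[OF t(2), of q] touching_norm[OF t(1)] by (intro mult_left_mono) auto
  ultimately show ?thesis
    by (simp add: norm_mult c_def)
qed

text \<open>One touching functional per neighbourhood suffices, and finiteness turns approximate
  norming into attainment. The last claim is restricted to nonzero \<open>x\<close> because
  \<open>F\<close> is empty for the zero space.\<close>

lemma finite_norming_family:
  assumes fin: "finite (smooth_out_nbhds scale N)"
  obtains F where "finite F" "card F \<le> card (smooth_out_nbhds scale N)"
    "\<And>f. f \<in> F \<Longrightarrow> Vector_Spaces.linear scale (*) f"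
    "\<And>f x. f \<in> F \<Longrightarrow> norm (f x) \<le> N x"
    "\<And>x. x \<noteq> 0 \<Longrightarrow> \<exists>f\<in>F. norm (f x) = N x"
proof -
  define T where "T = {(p, q). touching p q}"
  define nb where "nb = (\<lambda>(p :: 'a, q). out_nbhd scale N (line scale q))"
  have sub: "nb ` T \<subseteq> smooth_out_nbhds scale N"
    using touching_out_nbhd(2) by (auto simp: T_def nb_def)
  then have finT: "finite (nb ` T)"
    using fin finite_subset by blast
  \<comment> \<open>The inverse of \<open>nb\<close> selects one touching pair for every
    neighbourhood that occurs.\<close>
  define F where "F = (\<lambda>(p, q). touch_functional p q) ` inv_into T nb ` nb ` T"
  show thesis
  proof
    show finF: "finite F"
      unfolding F_def using finT by blast
    have "card F \<le> card (nb ` T)"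
      unfolding F_def using finT by (meson card_image_le finite_imageI order_trans)
    then show "card F \<le> card (smooth_out_nbhds scale N)"
      using card_mono[OF fin sub] by linarith
    have F: "\<exists>p q. touching p q \<and> f = touch_functional p q" if "f \<in> F" for f
      using that inv_into_into[of _ nb T] by (fastforce simp: F_def T_def)
    show "Vector_Spaces.linear scale (*) f" if "f \<in> F" for f
      using F[OF that] touch_functional_linear by blast
    show le: "norm (f x) \<le> N x" if "f \<in> F" for f x
      using F[OF that] touch_functional_le by blast
    have dominated: "\<exists>f\<in>F. norm (touch_functional p q x) \<le> norm (f x)" if t: "touching p q" for p q x
    proof -
      have "nb (p, q) \<in> nb ` T"
        using t by (simp add: T_def)
      note w = inv_into_into[OF this] f_inv_into_f[OF this]
      obtain p' q' where pq: "inv_into T nb (nb (p, q)) = (p', q')"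
        by fastforce
      have "(\<lambda>(p, q). touch_functional p q) (inv_into T nb (nb (p, q))) \<in> F"
        unfolding F_def using t by (intro imageI) (simp add: T_def)
      then have "touch_functional p' q' \<in> F"
        by (simp add: pq)
      moreover have "norm (touch_functional p q x) \<le> norm (touch_functional p' q' x)"
        using w pq t by (intro touch_functional_norm_le) (auto simp: T_def nb_def)
      ultimately show ?thesis by blast
    qed
    have unit: "\<exists>f\<in>F. norm (f x) = N x" if x: "N x = 1" for x
    proof -
      have ex: "\<exists>f\<in>F. 1 - \<epsilon> \<le> norm (f x)" if "\<epsilon> > 0" for \<epsilon>
      proof -
        obtain p q where t: "touching p q" "1 - \<epsilon> \<le> norm (touch_functional p q x)"
          using touching_norming_unit[OF x \<open>\<epsilon> > 0\<close>] by blast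
        then show ?thesis
          using dominated[OF t(1), of x] by (meson order_trans)
      qed
      \<comment> \<open>A single functional attaining the maximum must serve every
        \<open>\<epsilon>\<close>, whereas \<open>ex\<close> may supply a different one each
        time.\<close>
      define m where "m = Max ((\<lambda>f. norm (f x)) ` F)"
      have "F \<noteq> {}"
        using ex[of 1] by auto
      then have "m \<in> (\<lambda>f. norm (f x)) ` F"
        unfolding m_def using finF by (intro Max_in) auto
      then obtain f where f: "f \<in> F" "m = norm (f x)"
        by blast
      have "1 \<le> m + \<epsilon>" if "\<epsilon> > 0" for \<epsilon>
      proof -
        obtain g where "g \<in> F" "1 - \<epsilon> \<le> norm (g x)"
          using ex[OF \<open>\<epsilon> > 0\<close>] by blast
        moreover have "norm (g x) \<le> m"
          unfolding m_def using finF \<open>g \<in> F\<close> by (intro Max_ge) auto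
        ultimately show ?thesis by linarith
      qed
      then have "1 \<le> m"
        by (rule field_le_epsilon)
      then show ?thesis
        using f le[of f x] x by (intro bexI[of _ f]) auto
    qed
    show "\<exists>f\<in>F. norm (f x) = N x" if x: "x \<noteq> 0" for x
    proof -
      have "N (of_real (inverse (N x)) \<odot> x) = 1"
        using x unfolding N_scale norm_of_real by simp
      from unit[OF this] obtain f where f: "f \<in> F" "norm (f (of_real (inverse (N x)) \<odot> x)) = 1"
        using \<open>N (of_real (inverse (N x)) \<odot> x) = 1\<close> by auto
      obtain p q where "touching p q" "f = touch_functional p q"
        using F[OF f(1)] by blast
      then have "f (of_real (inverse (N x)) \<odot> x) = of_real (inverse (N x)) * f x"
        using touch_functional_linear[of p q] unfolding Vector_Spaces.linear_iff by blast
      then have "inverse (N x) * norm (f x) = 1"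
        using f(2) by (simp add: norm_mult norm_inverse)
      then have "norm (f x) = N x"
        using x by (simp add: field_simps)
      then show ?thesis using f by blast
    qed
  qed
qed

section \<open>Embedding into tuples and comparison of dimensions\<close>

text \<open>The norming functionals serve as coordinates. The resulting map preserves the norm, and
  definiteness of \<open>N\<close> makes it injective.\<close>

lemma norming_embedding:
  assumes fin: "finite (smooth_out_nbhds scale N)"
  obtains n A where "n \<le> card (smooth_out_nbhds scale N)"
    "Vector_Spaces.linear scale tuple_scale A" "inj A" "range A \<subseteq> tuples n"
    "\<And>x. N x = max_norm n (A x)"
proof -
  obtain F where F: "finite F" "card F \<le> card (smooth_out_nbhds scale N)"
    and lin: "\<And>f. f \<in> F \<Longrightarrow> Vector_Spaces.linear scale (*) f"
    and le: "\<And>f x. f \<in> F \<Longrightarrow> norm (f x) \<le> N x"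
    and att: "\<And>x. x \<noteq> 0 \<Longrightarrow> \<exists>f\<in>F. norm (f x) = N x"
    using finite_norming_family[OF fin] by metis
  obtain h where h: "bij_betw h {..<card F} F"
    using ex_bij_betw_nat_finite[OF F(1)] by (auto simp: atLeast0LessThan)
  then have hF: "i < card F \<Longrightarrow> h i \<in> F" for i
    by (auto simp: bij_betw_def)
  define A where "A x = (\<lambda>i. if i < card F then h i x else 0)" for x
  have linA: "Vector_Spaces.linear scale tuple_scale A"
    using lin[OF hF] unfolding Vector_Spaces.linear_iff A_def
    by (auto simp: vector_space_axioms tuple.vector_space_axioms tuple_scale_def fun_eq_iff)
  have N_eq: "N x = max_norm (card F) (A x)" for x
  proof (rule antisym)
    show "max_norm (card F) (A x) \<le> N x"
      using le[OF hF] by (simp add: max_norm_le_iff A_def)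
    show "N x \<le> max_norm (card F) (A x)"
    proof (cases "x = 0")
      case False
      then obtain f where "f \<in> F" "norm (f x) = N x"
        using att[OF False] by (elim bexE)
      moreover have "F = h ` {..<card F}"
        using h by (simp add: bij_betw_def)
      ultimately obtain i where "i < card F" "norm (h i x) = N x"
        by (metis imageE lessThan_iff)
      then show ?thesis
        using norm_le_max_norm[of i "card F" "A x"] by (simp add: A_def)
    qed (simp add: max_norm_nonneg)
  qed
  have "inj A"
  proof (rule injI)
    fix x y assume "A x = A y"
    then have "A (x - y) = A 0"
      using module_hom.diff[of scale tuple_scale A x y] module_hom.zero[of scale tuple_scale A] linA
      by (simp add: Vector_Spaces.linear_def)
    then have "N (x - y) = N 0"
      by (simp only: N_eq)
    then show "x = y" by simp
  qed
  moreover have "range A \<subseteq> tuples (card F)"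
    by (auto simp: A_def tuples_def)
  ultimately show thesis
    using that F(2) linA N_eq by blast
qed

lemma dim_le_card_smooth_out_nbhds:
  assumes "finite (smooth_out_nbhds scale N)"
  shows "card Basis \<le> card (smooth_out_nbhds scale N)"
  using norming_embedding[OF assms] dim_le_tuples(1) by (metis order_trans)

text \<open>The number of coordinates is at most the number of neighbourhoods and at least the
  dimension. When these agree, the embedding is onto.\<close>

lemma isometric_if_dim_many:
  assumes "finite (smooth_out_nbhds scale N)" and card: "card (smooth_out_nbhds scale N) = card Basis"
  shows "isometric_to_max_norm scale N"
proof -
  obtain n A where n: "n \<le> card Basis" and A: "Vector_Spaces.linear scale tuple_scale A" "inj A"
    "range A \<subseteq> tuples n" and N: "\<And>x. N x = max_norm n (A x)"
    using norming_embedding[OF assms(1)] unfolding card by metis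
  have "card Basis = n"
    using n dim_le_tuples(1)[OF A] by simp
  then have "bij_betw A UNIV (tuples n)"
    using dim_le_tuples(2)[OF A] A(2) by (simp add: bij_betw_def)
  then show ?thesis
    using A(1) N unfolding isometric_to_max_norm_def by blast
qed

section \<open>Smooth points of the maximum norm\<close>

text \<open>
  In the maximum norm a vector is smooth only if a single coordinate has maximal modulus, because
  every coordinate of maximal modulus yields a supporting functional.
\<close>

lemma max_norm_smooth_bj:
  assumes lin: "Vector_Spaces.linear scale tuple_scale A" and range: "range A = tuples n"
    and N_eq: "\<And>x. N x = max_norm n (A x)" and x: "smooth_vector scale N x"
  obtains i where "i < n" "\<And>y. bj_orthogonal scale N x y \<longleftrightarrow> A y i = 0"
proof -
  have x0: "x \<noteq> 0" and uniq: "\<And>f g. supporting_functional scale N x f \<Longrightarrow>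
      supporting_functional scale N x g \<Longrightarrow> f = g"
    using x by (auto simp: smooth_vector_def)
  have A: "A (y + z) i = A y i + A z i" "A (c \<odot> y) i = c * A y i" for y z c i
    using lin by (auto simp: Vector_Spaces.linear_iff tuple_scale_def)
  have pos: "0 < N x"
    using x0 by simp
  have le: "norm (A y i) \<le> N y" if "i < n" for y i
    using norm_le_max_norm[OF that, of "A y"] by (simp add: N_eq)
  obtain i where i: "i < n" "norm (A x i) = N x"
    using max_norm_attained[of n "A x"] pos by (auto simp: N_eq)
  \<comment> \<open>The evaluation at coordinate \<open>j\<close>, multiplied by a scalar that makes
    its value at \<open>x\<close> equal to \<open>N x\<close>; this scalar has modulus 1 when
    coordinate \<open>j\<close> is maximal.\<close>
  define f where "f j y = A y j * (of_real (N x) / A x j)" for j y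
  have f: "supporting_functional scale N x (f j)" if j: "j < n" "norm (A x j) = N x" for j
  proof -
    have "Vector_Spaces.linear scale (*) (f j)"
      unfolding Vector_Spaces.linear_iff f_def
      by (auto simp: vector_space_axioms A algebra_simps add_divide_distrib intro!: vector_space.intro)
    moreover have "norm (f j y) \<le> N y" for y
      using le[OF j(1), of y] pos j(2) by (simp add: f_def norm_mult norm_divide)
    moreover have "A x j \<noteq> 0"
      using j pos by auto
    ultimately show ?thesis
      by (simp add: supporting_functional_iff[OF x0] f_def)
  qed
  have less: "norm (A x j) < N x" if j: "j < n" "j \<noteq> i" for j
  proof (rule ccontr)
    assume "\<not> norm (A x j) < N x"
    then have "norm (A x j) = N x"
      using le[OF j(1), of x] by simp
    then have eq: "f i = f j"
      using uniq f i j by blast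
    \<comment> \<open>Surjectivity onto the tuples supplies a vector that separates
      \<open>f i\<close> from \<open>f j\<close>.\<close>
    have "tuple_unit i \<in> range A"
      using i range tuple_unit_in_tuples by blast
    then obtain e where e: "A e = tuple_unit i"
      by (metis imageE)
    have "f i e \<noteq> 0" "f j e = 0"
      using i j pos by (auto simp: f_def e tuple_unit_def)
    with eq show False by simp
  qed
  show thesis
  proof
    fix y
    show "bj_orthogonal scale N x y \<longleftrightarrow> A y i = 0"
    proof
      assume "A y i = 0"
      then have "A (x + c \<odot> y) i = A x i" for c
        by (simp add: A)
      then show "bj_orthogonal scale N x y"
        using le[OF i(1)] i(2) unfolding bj_orthogonal_def by metis
    next
      assume bj: "bj_orthogonal scale N x y"
      show "A y i = 0"
      proof (rule ccontr)
        assume y: "A y i \<noteq> 0"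
        \<comment> \<open>Adding \<open>c t\<close> times \<open>y\<close> shrinks the maximal
          coordinate to \<open>(1 - t) * A x i\<close>. The other coordinates are strictly smaller
          in modulus and stay so for small \<open>t\<close> by continuity.\<close>
        define c where "c t = - of_real t * A x i / A y i" for t
        have "\<forall>\<^sub>F t in at_right 0. norm (A x j + c t * A y j) < N x" if j: "j < n" for j
        proof (cases "j = i")
          case True
          have "\<forall>\<^sub>F t in at_right 0. 0 < t \<and> t < (1::real)"
            using eventually_at_right_real[of 0 "1::real"] by simp
          then show ?thesis
          proof eventually_elim
            case (elim t)
            have "A x j + c t * A y j = of_real (1 - t) * A x i"
              using y True by (simp add: c_def algebra_simps)
            also have "norm \<dots> = (1 - t) * N x"
              unfolding norm_mult norm_of_real i(2) using elim by simp
            finally show ?case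
              using elim pos by simp
          qed
        next
          case False
          have "((\<lambda>t. norm (A x j + c t * A y j)) \<longlongrightarrow> norm (A x j + c 0 * A y j)) (at_right 0)"
            unfolding c_def by (intro tendsto_intros) (use y in auto)
          then show ?thesis
            using less[OF j False] by (intro order_tendstoD(2)) (auto simp: c_def)
        qed
        then have "\<forall>\<^sub>F t in at_right 0. \<forall>j\<in>{..<n}. norm (A x j + c t * A y j) < N x"
          by (intro eventually_ball_finite) auto
        then obtain t where "\<forall>j\<in>{..<n}. norm (A x j + c t * A y j) < N x"
          using eventually_happens'[OF trivial_limit_at_right_real] by blast
        then have "N (x + c t \<odot> y) < N x"
          using pos unfolding N_eq[of "x + c t \<odot> y"] max_norm_less_iff by (simp add: A)
        then show False
          using bj by (simp add: bj_orthogonal_def not_less[symmetric])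
      qed
    qed
  qed (rule i(1))
qed

text \<open>Smooth points have only coordinate hyperplanes as neighbourhoods, which bounds the count
  by \<open>n\<close>. The opposite bound holds for every norm, so no smooth point has to be
  exhibited for each hyperplane.\<close>

lemma dim_many_if_isometric:
  assumes "isometric_to_max_norm scale N"
  shows "finite (smooth_out_nbhds scale N)" "card (smooth_out_nbhds scale N) = card Basis"
proof -
  obtain n A where lin: "Vector_Spaces.linear scale tuple_scale A" and range: "range A = tuples n"
    and N_eq: "\<And>x. N x = max_norm n (A x)"
    using assms by (auto simp: isometric_to_max_norm_def bij_betw_def)
  have sub: "smooth_out_nbhds scale N \<subseteq> (\<lambda>i. {line scale y | y. y \<noteq> 0 \<and> A y i = 0}) ` {..<n}"
  proof
    fix S assume "S \<in> smooth_out_nbhds scale N"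
    then obtain x where x: "smooth_vector scale N x" and S: "S = out_nbhd scale N (line scale x)"
      by (auto simp: smooth_out_nbhds_eq)
    obtain i where "i < n" "\<And>y. bj_orthogonal scale N x y \<longleftrightarrow> A y i = 0"
      using max_norm_smooth_bj[OF lin range N_eq x] by metis
    moreover have "x \<noteq> 0"
      using x by (simp add: smooth_vector_def)
    ultimately have "S = {line scale y | y. y \<noteq> 0 \<and> A y i = 0}"
      unfolding S by (intro out_nbhd_line_eqI) auto
    with \<open>i < n\<close> show "S \<in> (\<lambda>i. {line scale y | y. y \<noteq> 0 \<and> A y i = 0}) ` {..<n}"
      by blast
  qed
  then show fin: "finite (smooth_out_nbhds scale N)"
    using finite_subset by blast
  have "card (smooth_out_nbhds scale N) \<le> n"
    using surj_card_le[OF _ sub] by simp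
  then show "card (smooth_out_nbhds scale N) = card Basis"
    using tuples_le_dim[OF lin, of n] range dim_le_card_smooth_out_nbhds[OF fin] by simp
qed

lemma isometric_iff_dim_many:
  "isometric_to_max_norm scale N \<longleftrightarrow> dim_many_smooth_out_nbhds scale N"
  using isometric_if_dim_many dim_many_if_isometric
  by (auto simp: dim_many_smooth_out_nbhds_def)

end

section \<open>Minimality among all norms, and the real and complex cases\<close>

context inner_coords
begin

text \<open>The dimension is a lower bound for every norm and is attained by a maximum norm, so it
  is the minimal cardinality.\<close>

lemma minimal_iff_dim_many:
  assumes "norm_on scale N"
  shows "minimal_smooth_out_nbhds scale N \<longleftrightarrow> dim_many_smooth_out_nbhds scale N"
proof -
  have coords: "normed_coords scale Basis cj M" if "norm_on scale M" for M
    using that by unfold_locales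
  interpret N: normed_coords scale Basis cj N
    by (rule coords[OF assms])
  show ?thesis
  proof
    assume min: "minimal_smooth_out_nbhds scale N"
    obtain M where M: "norm_on scale M" "isometric_to_max_norm scale M"
      using exists_max_norm by blast
    interpret M: normed_coords scale Basis cj M
      by (rule coords[OF M(1)])
    have le: "smooth_out_nbhds scale N \<lesssim> smooth_out_nbhds scale M"
      using min M(1) by (simp add: minimal_smooth_out_nbhds_def)
    have fin: "finite (smooth_out_nbhds scale N)"
      using le M.dim_many_if_isometric(1)[OF M(2)] unfolding lepoll_def by (auto dest: inj_on_finite)
    have "card (smooth_out_nbhds scale N) \<le> card Basis"
      using lepoll_iff_card_le[OF fin M.dim_many_if_isometric(1)[OF M(2)]] le
        M.dim_many_if_isometric(2)[OF M(2)] by simp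
    then show "dim_many_smooth_out_nbhds scale N"
      using fin N.dim_le_card_smooth_out_nbhds by (simp add: dim_many_smooth_out_nbhds_def)
  next
    assume dim: "dim_many_smooth_out_nbhds scale N"
    show "minimal_smooth_out_nbhds scale N"
      unfolding minimal_smooth_out_nbhds_def
    proof (intro allI impI)
      fix M assume "norm_on scale M"
      then interpret M: normed_coords scale Basis cj M
        by (rule coords)
      \<comment> \<open>For infinitely many neighbourhoods of \<open>M\<close> the injection comes
        from finiteness on the side of \<open>N\<close>; otherwise cardinalities are
        compared.\<close>
      show "smooth_out_nbhds scale N \<lesssim> smooth_out_nbhds scale M"
        using dim M.dim_le_card_smooth_out_nbhds
        by (cases "finite (smooth_out_nbhds scale M)")
          (auto simp: dim_many_smooth_out_nbhds_def lepoll_iff_card_le finite_lepoll_infinite)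
    qed
  qed
qed

lemma isometric_iff_minimal:
  assumes "norm_on scale N"
  shows "isometric_to_max_norm scale N \<longleftrightarrow> minimal_smooth_out_nbhds scale N"
proof -
  interpret N: normed_coords scale Basis cj N
    using assms by unfold_locales
  show ?thesis
    using N.isometric_iff_dim_many minimal_iff_dim_many[OF assms] by simp
qed

end

theorem theorem1p4:
  fixes sR :: "real \<Rightarrow> 'a::ab_group_add \<Rightarrow> 'a" and BR :: "'a set" and NR :: "'a \<Rightarrow> real"
    and sC :: "complex \<Rightarrow> 'b::ab_group_add \<Rightarrow> 'b" and BC :: "'b set" and NC :: "'b \<Rightarrow> real"
  shows
    "(finite_dimensional_vector_space sR BR \<and> norm_on sR NR \<longrightarrow>
        (isometric_to_max_norm sR NR \<longleftrightarrow> minimal_smooth_out_nbhds sR NR) \<and>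
        (minimal_smooth_out_nbhds sR NR \<longleftrightarrow> dim_many_smooth_out_nbhds sR NR)) \<and>
     (finite_dimensional_vector_space sC BC \<and> norm_on sC NC \<longrightarrow>
        (isometric_to_max_norm sC NC \<longleftrightarrow> minimal_smooth_out_nbhds sC NC) \<and>
        (minimal_smooth_out_nbhds sC NC \<longleftrightarrow> dim_many_smooth_out_nbhds sC NC))"
proof -
  have "inner_coords sR BR (\<lambda>a. a)" if "finite_dimensional_vector_space sR BR"
    using that by (intro inner_coords.intro inner_coords_axioms.intro) (auto simp: power2_eq_square)
  moreover have "inner_coords sC BC cnj" if "finite_dimensional_vector_space sC BC"
    using that by (intro inner_coords.intro inner_coords_axioms.intro) (auto simp: complex_norm_square simp del: of_real_power)
  ultimately show ?thesis
    using inner_coords.isometric_iff_minimal inner_coords.minimal_iff_dim_many by metis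
qed

end
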